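(* In the setting of the context (including the exactness assumption), suppose the original problem is convex (all $\mathcal F_n$ are convex sets and all $f_n$ are convex functions) and $\psi_n(x)=\|x\|$ for all nodes $n$. Let $(\bar x_n,\bar y_n)_{n\in\mathcal N}$ be an optimal solution of the original problem and suppose the bounds satisfy $l_{n,\lambda}\ge\sigma_n$ and $l_{n,\rho}=0$ for all nodes $n\ne r$. For each $n\ne r$ put $\bar x=\bar x_{a(n)}$, let $\hat v_n$ be the optimal value and $(\hat\lambda_n,\hat\rho_n)$ an optimal outer solution of $$\max_{(\lambda,\rho)\in\mathcal U_n}\ \min_{z\in\mathcal X_{a(n)}}\big[Q_n(z)+\langle\lambda,\bar x-z\rangle+\rho\,\psi_n(\bar x-z)\big],$$ and define the cut $C_n(x)=-\langle\hat\lambda_n,\bar x-x\rangle-\hat\rho_n\psi_n(\bar x-x)+\hat v_n$, $x\in\mathcal X_{a(n)}$. Then for every node $n\ne r$ the cut is exact at $\bar x_{a(n)}$, i.e. $Q_n(\bar x_{a(n)})=C_n(\bar x_{a(n)})$.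
   Context: $\mathcal N$ is the node set of a finite rooted scenario tree with root $r$; $a(n)$ is the parent and $\mathcal C(n)$ the set of children of $n$. $p_n>0$ is the probability of node $n$, $p_r=1$, $p_{nm}=p_m/p_n$ for $m\in\mathcal C(n)$. For each $n$, $\mathcal F_n$ is a compact set of pairs $(x_n,y_n)$ in a Euclidean space and $\mathcal X_n$ is its projection onto the $x_n$-coordinates; $x_{a(r)}=0$, $\mathcal X_{a(r)}=\{0\}$. The cost $f_n(z,y,x)\in[0,+\infty]$, defined for $z\in\mathcal X_{a(n)}$, $(x,y)\in\mathcal F_n$, is lower semicontinuous, and some choice of $(x_n,y_n)\in\mathcal F_n$, $n\in\mathcal N$, gives $\sum_n p_nf_n(x_{a(n)},y_n,x_n)<+\infty$. The original problem is $\min\{\sum_n p_nf_n(x_{a(n)},y_n,x_n):(x_n,y_n)\in\mathcal F_n\ \forall n\}$. Value functions, recursively from the leaves: $Q_n(x_{a(n)})=\min_{(x,y)\in\mathcal F_n}\{f_n(x_{a(n)},y,x)+\sum_{m\in\mathcal C(n)}p_{nm}Q_m(x)\}$. $\|\cdot\|$ is a norm with dual norm $\|\cdot\|_*$, and $\sigma_n>0$ are given. Exactness assumption: every optimal solution of $\min\{\sum_n p_n(f_n(z_n,y_n,x_n)+\sigma_n\psi_n(x_{a(n)}-z_n)):(x_n,y_n)\in\mathcal F_n,\ z_n\in\mathcal X_{a(n)}\ \forall n\}$ satisfies $z_n=x_{a(n)}$ for all $n$. For $n\ne r$, $\mathcal U_n=\{(\lambda,\rho):\|\lambda\|_*\le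 l_{n,\lambda},\ 0\le\rho\le l_{n,\rho}\}$. *)

theory Defs
  imports "HOL-Analysis.Analysis"
begin

section \<open>Norms, lower semicontinuity and convexity\<close>

text \<open>An arbitrary norm on a Euclidean space; the library constant \<open>norm\<close> is only the
  Euclidean one.\<close>

definition is_norm :: "('x::real_vector \<Rightarrow> real) \<Rightarrow> bool" where
  "is_norm \<nu> \<longleftrightarrow>
     (\<forall>x. \<nu> x = 0 \<longleftrightarrow> x = 0) \<and>
     (\<forall>c x. \<nu> (c *\<^sub>R x) = \<bar>c\<bar> * \<nu> x) \<and>
     (\<forall>x y. \<nu> (x + y) \<le> \<nu> x + \<nu> y)"

definition dual_norm :: "('x::real_inner \<Rightarrow> real) \<Rightarrow> 'x \<Rightarrow> real" where
  "dual_norm \<nu> l = (SUP x \<in> {x. \<nu> x \<le> 1}. inner l x)"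

text \<open>Lower semicontinuity relative to the domain \<open>S\<close>.\<close>

definition lsc_on :: "'a::topological_space set \<Rightarrow> ('a \<Rightarrow> ereal) \<Rightarrow> bool" where
  "lsc_on S g \<longleftrightarrow> (\<forall>u\<in>S. g u \<le> Liminf (at u within S) g)"

text \<open>The library's \<open>convex_on\<close> covers real-valued functions only. This version is used for
  functions with values in \<open>[0,\<infinity>]\<close>, so the right-hand side never has the form \<open>\<infinity> - \<infinity>\<close>.\<close>

definition ereal_convex_on :: "'a::real_vector set \<Rightarrow> ('a \<Rightarrow> ereal) \<Rightarrow> bool" where
  "ereal_convex_on S g \<longleftrightarrow> convex S \<and>
     (\<forall>u\<in>S. \<forall>v\<in>S. \<forall>t\<in>{0..1}.
        g ((1 - t) *\<^sub>R u + t *\<^sub>R v) \<le> ereal (1 - t) * g u + ereal t * g v)"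


section \<open>Scenario trees\<close>

text \<open>The value of \<open>par\<close> at the root is irrelevant: the (virtual) parent of the root is treated
  separately in \<open>parent_state\<close> and \<open>parent_set\<close> below.\<close>

locale scenario_tree =
  fixes nodes :: "'n set" and root :: 'n and par :: "'n \<Rightarrow> 'n"
  assumes finite_nodes: "finite nodes"
    and root_in: "root \<in> nodes"
    and par_in: "\<And>n. n \<in> nodes \<Longrightarrow> n \<noteq> root \<Longrightarrow> par n \<in> nodes"
    and reaches_root: "\<And>n. n \<in> nodes \<Longrightarrow> \<exists>k. (par ^^ k) n = root"
begin

definition children :: "'n \<Rightarrow> 'n set" where
  "children n = {m \<in> nodes. m \<noteq> root \<and> par m = n}"

definition depth :: "'n \<Rightarrow> nat" where
  "depth n = (LEAST k. (par ^^ k) n = root)"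

lemma depth_child:
  assumes "m \<in> children n"
  shows "depth m = Suc (depth n)"
proof -
  from assms have m: "m \<in> nodes" "m \<noteq> root" "par m = n"
    by (auto simp: children_def)
  obtain k where k: "(par ^^ k) m = root"
    using reaches_root m(1) by blast
  have "depth m = Suc (LEAST k. (par ^^ Suc k) m = root)"
    unfolding depth_def by (rule Least_Suc[where P = "\<lambda>k. (par ^^ k) m = root", OF k]) (use m(2) in simp)
  then show ?thesis
    by (simp add: depth_def funpow_Suc_right m(3) del: funpow.simps)
qed

lemma wf_children: "wf {(m, n). m \<in> children n}"
proof -
  define D where "D = Max (depth ` nodes)"
  have "{(m, n). m \<in> children n} \<subseteq> Wellfounded.measure (\<lambda>n. Suc D - depth n)"
  proof clarsimp
    fix m n assume mn: "m \<in> children n"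
    then have "m \<in> nodes" by (simp add: children_def)
    then have "depth m \<le> D"
      unfolding D_def using finite_nodes by simp
    then show "Suc D - depth m < Suc D - depth n"
      using depth_child[OF mn] by simp
  qed
  then show ?thesis by (rule wf_subset[rotated]) simp
qed

end


section \<open>Multistage problems\<close>

text \<open>All state vectors live in one Euclidean space \<open>'x\<close> and all internal vectors in one
  Euclidean space \<open>'y\<close>. The argument order is \<open>f n z y x\<close>, with \<open>z\<close> the parent state. The
  definitions do not depend on the values of \<open>x n\<close>, \<open>y n\<close>, \<open>z n\<close> and \<open>F n\<close> outside \<open>nodes\<close>.\<close>

locale multistage_base = scenario_tree nodes root par
  for nodes :: "'n set" and root :: 'n and par :: "'n \<Rightarrow> 'n" +
  fixes p :: "'n \<Rightarrow> real"
    and F :: "'n \<Rightarrow> ('x::euclidean_space \<times> 'y::euclidean_space) set"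
    and f :: "'n \<Rightarrow> 'x \<Rightarrow> 'y \<Rightarrow> 'x \<Rightarrow> ereal"
begin

definition state_set :: "'n \<Rightarrow> 'x set" where
  "state_set n = fst ` F n"

definition parent_set :: "'n \<Rightarrow> 'x set" where
  "parent_set n = (if n = root then {0} else state_set (par n))"

definition parent_state :: "('n \<Rightarrow> 'x) \<Rightarrow> 'n \<Rightarrow> 'x" where
  "parent_state x n = (if n = root then 0 else x (par n))"

definition cost_domain :: "'n \<Rightarrow> ('x \<times> 'y \<times> 'x) set" where
  "cost_domain n = {(z, y, x). z \<in> parent_set n \<and> (x, y) \<in> F n}"

definition feasible :: "('n \<Rightarrow> 'x) \<Rightarrow> ('n \<Rightarrow> 'y) \<Rightarrow> bool" where
  "feasible x y \<longleftrightarrow> (\<forall>n\<in>nodes. (x n, y n) \<in> F n)"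

definition cost :: "('n \<Rightarrow> 'x) \<Rightarrow> ('n \<Rightarrow> 'y) \<Rightarrow> ereal" where
  "cost x y = (\<Sum>n\<in>nodes. ereal (p n) * f n (parent_state x n) (y n) (x n))"

definition optimal :: "('n \<Rightarrow> 'x) \<Rightarrow> ('n \<Rightarrow> 'y) \<Rightarrow> bool" where
  "optimal x y \<longleftrightarrow> feasible x y \<and> (\<forall>x' y'. feasible x' y' \<longrightarrow> cost x y \<le> cost x' y')"

text \<open>The value functions. Under the standing assumptions (compactness and lower
  semicontinuity) the infimum is attained for every \<open>z \<in> parent_set n\<close>.\<close>

function value_fun :: "'n \<Rightarrow> 'x \<Rightarrow> ereal" where
  "value_fun n z =
     (INF (x, y) \<in> F n. f n z y x + (\<Sum>m\<in>children n. ereal (p m / p n) * value_fun m x))"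
  by auto
termination
  by (relation "inv_image {(m, n). m \<in> children n} fst") (auto simp: wf_children)

declare value_fun.simps [simp del]

definition reg_feasible :: "('n \<Rightarrow> 'x) \<Rightarrow> ('n \<Rightarrow> 'y) \<Rightarrow> ('n \<Rightarrow> 'x) \<Rightarrow> bool" where
  "reg_feasible x y z \<longleftrightarrow> feasible x y \<and> (\<forall>n\<in>nodes. z n \<in> parent_set n)"

definition reg_cost ::
  "('n \<Rightarrow> real) \<Rightarrow> ('n \<Rightarrow> 'x \<Rightarrow> real) \<Rightarrow> ('n \<Rightarrow> 'x) \<Rightarrow> ('n \<Rightarrow> 'y) \<Rightarrow> ('n \<Rightarrow> 'x) \<Rightarrow> ereal" where
  "reg_cost \<sigma> \<psi> x y z =
     (\<Sum>n\<in>nodes. ereal (p n) *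
        (f n (z n) (y n) (x n) + ereal (\<sigma> n * \<psi> n (parent_state x n - z n))))"

definition reg_optimal ::
  "('n \<Rightarrow> real) \<Rightarrow> ('n \<Rightarrow> 'x \<Rightarrow> real) \<Rightarrow> ('n \<Rightarrow> 'x) \<Rightarrow> ('n \<Rightarrow> 'y) \<Rightarrow> ('n \<Rightarrow> 'x) \<Rightarrow> bool" where
  "reg_optimal \<sigma> \<psi> x y z \<longleftrightarrow> reg_feasible x y z \<and>
     (\<forall>x' y' z'. reg_feasible x' y' z' \<longrightarrow> reg_cost \<sigma> \<psi> x y z \<le> reg_cost \<sigma> \<psi> x' y' z')"

definition exact_regularization :: "('n \<Rightarrow> real) \<Rightarrow> ('n \<Rightarrow> 'x \<Rightarrow> real) \<Rightarrow> bool" where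
  "exact_regularization \<sigma> \<psi> \<longleftrightarrow>
     (\<forall>x y z. reg_optimal \<sigma> \<psi> x y z \<longrightarrow> (\<forall>n\<in>nodes. z n = parent_state x n))"

text \<open>The inner minimum of the cut-generating problem at \<open>xb\<close>, as a function of the
  multipliers, and its outer maximization over a set \<open>U\<close> of multipliers.\<close>

definition dual_fun :: "('n \<Rightarrow> 'x \<Rightarrow> real) \<Rightarrow> 'n \<Rightarrow> 'x \<Rightarrow> 'x \<times> real \<Rightarrow> ereal" where
  "dual_fun \<psi> n xb = (\<lambda>(l, \<rho>).
     (INF z \<in> parent_set n.
        value_fun n z + ereal (inner l (xb - z)) + ereal (\<rho> * \<psi> n (xb - z))))"

definition dual_value :: "('n \<Rightarrow> 'x \<Rightarrow> real) \<Rightarrow> ('x \<times> real) set \<Rightarrow> 'n \<Rightarrow> 'x \<Rightarrow> ereal" where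
  "dual_value \<psi> U n xb = (SUP u \<in> U. dual_fun \<psi> n xb u)"

definition dual_optimal ::
  "('n \<Rightarrow> 'x \<Rightarrow> real) \<Rightarrow> ('x \<times> real) set \<Rightarrow> 'n \<Rightarrow> 'x \<Rightarrow> 'x \<times> real \<Rightarrow> bool" where
  "dual_optimal \<psi> U n xb u \<longleftrightarrow>
     u \<in> U \<and> (\<forall>u'\<in>U. dual_fun \<psi> n xb u' \<le> dual_fun \<psi> n xb u)"

end

definition multiplier_set :: "('x::real_inner \<Rightarrow> real) \<Rightarrow> real \<Rightarrow> real \<Rightarrow> ('x \<times> real) set" where
  "multiplier_set \<nu> bl br = {(l, \<rho>). dual_norm \<nu> l \<le> bl \<and> 0 \<le> \<rho> \<and> \<rho> \<le> br}"

text \<open>The cut generated at \<open>xb\<close>; here \<open>\<psi>\<close> is the penalty function of the node at hand and \<open>v\<close>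
  the optimal value of the cut-generating problem.\<close>

definition conjugacy_cut :: "('x::real_inner \<Rightarrow> real) \<Rightarrow> 'x \<Rightarrow> ereal \<Rightarrow> 'x \<Rightarrow> real \<Rightarrow> 'x \<Rightarrow> ereal" where
  "conjugacy_cut \<psi> xb v l \<rho> x = ereal (- inner l (xb - x) - \<rho> * \<psi> (xb - x)) + v"

locale multistage_problem = multistage_base nodes root par p F f
  for nodes :: "'n set" and root :: 'n and par :: "'n \<Rightarrow> 'n" and p :: "'n \<Rightarrow> real"
    and F :: "'n \<Rightarrow> ('x::euclidean_space \<times> 'y::euclidean_space) set"
    and f :: "'n \<Rightarrow> 'x \<Rightarrow> 'y \<Rightarrow> 'x \<Rightarrow> ereal" +
  assumes p_pos: "\<And>n. n \<in> nodes \<Longrightarrow> 0 < p n"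
    and p_root: "p root = 1"
    and compact_F: "\<And>n. n \<in> nodes \<Longrightarrow> compact (F n)"
    and f_nonneg: "\<And>n z y x. n \<in> nodes \<Longrightarrow> (z, y, x) \<in> cost_domain n \<Longrightarrow> 0 \<le> f n z y x"
    and f_lsc: "\<And>n. n \<in> nodes \<Longrightarrow> lsc_on (cost_domain n) (\<lambda>(z, y, x). f n z y x)"
    and finite_cost: "\<exists>x y. feasible x y \<and> cost x y < \<infinity>"
begin

definition convex_problem :: bool where
  "convex_problem \<longleftrightarrow>
     (\<forall>n\<in>nodes. convex (F n) \<and> ereal_convex_on (cost_domain n) (\<lambda>(z, y, x). f n z y x))"

end

end

theory Submission
  imports Defs
begin

text \<open>Fix \<open>n \<noteq> root\<close>. Splicing arbitrary decisions below \<open>n\<close> into the optimal solution, started from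
  a copy \<open>z\<close> of the parent state, yields a feasible point of the regularized problem. Since that
  problem attains its minimum, exactness forces its value to be the original one, so the cost of the
  optimal solution below \<open>n\<close> exceeds the cost of any other choice by at most
  \<open>p\<^sub>n \<sigma>\<^sub>n \<parallel>xb - z\<parallel>\<close>. The epigraph of the subtree costs is convex and hence can be
  separated from the hypograph of this concave penalty bound. The separating hyperplane gives a
  subgradient of the value function at \<open>xb\<close> of dual norm at most \<open>\<sigma>\<^sub>n\<close>, which is an admissible
  multiplier and closes the duality gap.\<close>

section \<open>Norms and separation\<close>

lemma is_norm_nonneg:
  assumes "is_norm \<nu>" shows "0 \<le> \<nu> x"
proof -
  have "\<nu> (x + (-1) *\<^sub>R x) \<le> \<nu> x + \<nu> ((-1) *\<^sub>R x)" "\<nu> ((-1) *\<^sub>R x) = \<bar>-1\<bar> * \<nu> x" "\<nu> 0 = 0"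
    using assms unfolding is_norm_def by blast+
  then show ?thesis by simp
qed

lemma is_norm_convex:
  assumes "is_norm \<nu>" shows "convex_on UNIV \<nu>"
proof (rule convex_onI)
  fix t :: real and x y assume t: "0 < t" "t < 1"
  have "\<nu> ((1 - t) *\<^sub>R x + t *\<^sub>R y) \<le> \<nu> ((1 - t) *\<^sub>R x) + \<nu> (t *\<^sub>R y)"
    "\<nu> ((1 - t) *\<^sub>R x) = \<bar>1 - t\<bar> * \<nu> x" "\<nu> (t *\<^sub>R y) = \<bar>t\<bar> * \<nu> y"
    using assms unfolding is_norm_def by blast+
  then show "\<nu> ((1 - t) *\<^sub>R x + t *\<^sub>R y) \<le> (1 - t) * \<nu> x + t * \<nu> y"
    using t by simp
qed simp

text \<open>A finite convex function on an open subset of a Euclidean space is continuous, which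
  replaces a comparison of \<open>\<nu>\<close> with the Euclidean norm.\<close>

lemma is_norm_continuous:
  fixes \<nu> :: "'x::euclidean_space \<Rightarrow> real"
  assumes "is_norm \<nu>" shows "continuous_on UNIV \<nu>"
  by (rule convex_on_continuous[OF open_UNIV is_norm_convex[OF assms]])

lemma dual_norm_le:
  assumes "is_norm \<nu>" and c: "0 \<le> c" and le: "\<And>x. inner l x \<le> c * \<nu> x"
  shows "dual_norm \<nu> l \<le> c"
  unfolding dual_norm_def
proof (rule cSUP_least)
  have "\<nu> 0 = 0" using assms(1) by (simp add: is_norm_def)
  then have "0 \<in> {x. \<nu> x \<le> 1}" by simp
  then show "{x. \<nu> x \<le> 1} \<noteq> {}" by blast
  fix x assume "x \<in> {x. \<nu> x \<le> 1}"
  then have "c * \<nu> x \<le> c * 1" using c by (intro mult_left_mono) auto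
  then show "inner l x \<le> c" using le[of x] by simp
qed

text \<open>A hyperplane between \<open>E\<close> and the region below the cone
  \<open>q - c * \<nu> (x0 - z)\<close> must pass through the apex \<open>(x0, q)\<close>. Being
  above the cone bounds its slope by \<open>c * \<nu>\<close>; being below \<open>E\<close> makes it
  a minorant.\<close>

lemma affine_minorant_of_penalty:
  fixes E :: "('x::euclidean_space \<times> real) set"
  assumes E: "convex E" and \<nu>: "is_norm \<nu>" and c: "0 \<le> c"
    and mem: "(x0, q) \<in> E"
    and pen: "\<And>z s. (z, s) \<in> E \<Longrightarrow> q \<le> s + c * \<nu> (x0 - z)"
  obtains l where "\<And>z. inner l z \<le> c * \<nu> z"
    and "\<And>z s. (z, s) \<in> E \<Longrightarrow> q + inner l (z - x0) \<le> s"
proof -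
  \<comment> \<open>The strict inequality keeps \<open>H\<close> disjoint from \<open>E\<close>,
    which may touch the cone.\<close>
  define H where "H = {(z, s). s < q - c * \<nu> (x0 - z)}"
  have nu_conv: "\<nu> (u *\<^sub>R a + v *\<^sub>R b) \<le> u * \<nu> a + v * \<nu> b" if "0 \<le> u" "0 \<le> v" "u + v = 1" for u v a b
    using is_norm_convex[OF \<nu>] that unfolding convex_on_def by auto
  have "convex H"
  proof (rule convexI)
    fix a b :: "'x \<times> real" and u v :: real
    assume ab: "a \<in> H" "b \<in> H" and uv: "0 \<le> u" "0 \<le> v" "u + v = 1"
    obtain z s w t where [simp]: "a = (z, s)" "b = (w, t)" by (cases a, cases b)
    have st: "s < q - c * \<nu> (x0 - z)" "t < q - c * \<nu> (x0 - w)" using ab by (auto simp: H_def)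
    have "x0 - (u *\<^sub>R z + v *\<^sub>R w) = u *\<^sub>R (x0 - z) + v *\<^sub>R (x0 - w)"
    proof -
      have "u *\<^sub>R x0 + v *\<^sub>R x0 = x0" using uv(3) by (metis scaleR_add_left scaleR_one)
      then show ?thesis by (simp add: algebra_simps)
    qed
    then have "\<nu> (x0 - (u *\<^sub>R z + v *\<^sub>R w)) \<le> u * \<nu> (x0 - z) + v * \<nu> (x0 - w)"
      using nu_conv[OF uv] by simp
    then have "c * \<nu> (x0 - (u *\<^sub>R z + v *\<^sub>R w)) \<le> c * (u * \<nu> (x0 - z) + v * \<nu> (x0 - w))"
      using c by (rule mult_left_mono)
    moreover have "u * s + v * t < u * (q - c * \<nu> (x0 - z)) + v * (q - c * \<nu> (x0 - w))"
    \<comment> \<open>Strictness survives only through a positive weight: through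
      \<open>v = 1\<close> if \<open>u = 0\<close>, and through \<open>u\<close> otherwise.\<close>
    proof (cases "u = 0")
      case True then show ?thesis using uv st by simp
    next
      case False
      then have "u * s < u * (q - c * \<nu> (x0 - z))" using uv(1) st(1) by simp
      moreover have "v * t \<le> v * (q - c * \<nu> (x0 - w))" using uv(2) st(2) by (intro mult_left_mono) auto
      ultimately show ?thesis by linarith
    qed
    moreover have "u * (q - c * \<nu> (x0 - z)) + v * (q - c * \<nu> (x0 - w))
        = (u + v) * q - c * (u * \<nu> (x0 - z) + v * \<nu> (x0 - w))" by (simp add: algebra_simps)
    ultimately have "u * s + v * t < q - c * \<nu> (x0 - (u *\<^sub>R z + v *\<^sub>R w))" using uv(3) by simp
    then show "u *\<^sub>R a + v *\<^sub>R b \<in> H" by (simp add: H_def)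
  qed
  moreover have "(x0, q - c * \<nu> (x0 - x0) - 1) \<in> H" by (simp add: H_def)
  then have "H \<noteq> {}" by blast
  moreover have "E \<noteq> {}" using mem by blast
  moreover have "H \<inter> E = {}" using pen by (force simp: H_def)
  ultimately obtain a b where ab: "a \<noteq> 0" "\<forall>x\<in>H. inner a x \<le> b" "\<forall>x\<in>E. inner a x \<ge> b"
    using separating_hyperplane_sets[of H E] E by metis
  obtain \<alpha> \<beta> where a: "a = (\<alpha>, \<beta>)" by (cases a)
  have h: "inner \<alpha> z + \<beta> * s \<le> b" if "s < q - c * \<nu> (x0 - z)" for z s
    using ab(2) that by (auto simp: H_def a inner_prod_def)
  have e: "b \<le> inner \<alpha> z + \<beta> * s" if "(z, s) \<in> E" for z s
    using ab(3) that by (force simp: a inner_prod_def)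
  have \<nu>0: "\<nu> 0 = 0" using \<nu> by (simp add: is_norm_def)
  have "0 \<le> \<beta>"
  proof -
    have "inner \<alpha> x0 + \<beta> * (q - 1) \<le> inner \<alpha> x0 + \<beta> * q"
      using h[of "q - 1" x0] e[OF mem] \<nu>0 by simp
    then show ?thesis by (simp add: algebra_simps)
  qed
  \<comment> \<open>A vertical hyperplane would bound the linear form of \<open>\<alpha>\<close> on
    the whole space, since \<open>H\<close> has points over every \<open>z\<close>. Moving from
    \<open>x0\<close> along \<open>\<alpha>\<close> then forces \<open>\<alpha> = 0\<close>.\<close>
  moreover have "\<beta> \<noteq> 0"
  proof
    assume [simp]: "\<beta> = 0"
    have "inner \<alpha> z \<le> inner \<alpha> x0" for z
      using h[of "q - c * \<nu> (x0 - z) - 1" z] e[OF mem] by simp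
    from this[of "x0 + \<alpha>"] have "inner \<alpha> \<alpha> \<le> 0" by (simp add: inner_add_right)
    then have "\<alpha> = 0" using inner_gt_zero_iff[of \<alpha>] by linarith
    then show False using ab(1) by (simp add: a zero_prod_def)
  qed
  ultimately have \<beta>: "0 < \<beta>" by simp
  \<comment> \<open>The bound extends from \<open>H\<close> to the surface of the cone: lowering the
    height by \<open>\<epsilon> / \<beta>\<close> costs exactly \<open>\<epsilon>\<close>.\<close>
  have h': "inner \<alpha> z + \<beta> * (q - c * \<nu> (x0 - z)) \<le> b" for z
  proof (rule field_le_epsilon)
    fix \<epsilon> :: real assume "0 < \<epsilon>"
    then show "inner \<alpha> z + \<beta> * (q - c * \<nu> (x0 - z)) \<le> b + \<epsilon>"
      using h[of "q - c * \<nu> (x0 - z) - \<epsilon> / \<beta>" z] \<beta> by (simp add: right_diff_distrib)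
  qed
  \<comment> \<open>Solving the hyperplane equation for the height gives the slope
    \<open>- \<alpha> / \<beta>\<close>.\<close>
  define l where "l = - (1 / \<beta>) *\<^sub>R \<alpha>"
  have \<alpha>: "inner \<alpha> z = - \<beta> * inner l z" for z using \<beta> by (simp add: l_def)
  show thesis
  proof
    fix z
    have "\<beta> * (q - inner l (x0 - z) - c * \<nu> z) \<le> \<beta> * (q - inner l x0)"
      using h'[of "x0 - z"] e[OF mem] by (simp add: \<alpha> algebra_simps)
    then show "inner l z \<le> c * \<nu> z" using \<beta> by (simp add: inner_diff_right)
  next
    fix z s assume "(z, s) \<in> E"
    then have "\<beta> * (q - inner l x0) \<le> \<beta> * (s - inner l z)"
      using e[of z s] h'[of x0] \<nu>0 by (simp add: \<alpha> algebra_simps)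
    then show "q + inner l (z - x0) \<le> s" using \<beta> by (simp add: inner_diff_right)
  qed
qed

section \<open>Lower semicontinuity\<close>

lemma lsc_onD: "lsc_on S g \<Longrightarrow> u \<in> S \<Longrightarrow> c < g u \<Longrightarrow> eventually (\<lambda>w. c < g w) (at u within S)"
  unfolding lsc_on_def le_Liminf_iff by blast

text \<open>Strict superlevel sets are relatively open, and continuity pulls them back.\<close>

lemma lsc_on_compose:
  assumes g: "lsc_on T g" and h: "continuous_on S h" and sub: "h ` S \<subseteq> T"
  shows "lsc_on S (\<lambda>u. g (h u))"
  unfolding lsc_on_def le_Liminf_iff
proof (intro ballI allI impI)
  fix u c assume u: "u \<in> S" and c: "c < g (h u)"
  have "eventually (\<lambda>w. c < g w) (at (h u) within T)"
    using lsc_onD[OF g _ c] u sub by blast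
  then obtain B where B: "open B" "h u \<in> B" "\<forall>w\<in>B. w \<noteq> h u \<longrightarrow> w \<in> T \<longrightarrow> c < g w"
    unfolding eventually_at_topological by blast
  have "eventually (\<lambda>w. h w \<in> B) (at u within S)"
    using h u B(1,2) by (auto simp: continuous_on_def tendsto_def)
  then show "eventually (\<lambda>w. c < g (h w)) (at u within S)"
  proof (rule eventually_mono[OF eventually_conj])
    show "eventually (\<lambda>w. w \<in> S) (at u within S)" by (auto simp: eventually_at_filter)
    show "c < g (h w)" if "h w \<in> B \<and> w \<in> S" for w
      \<comment> \<open>The filter \<open>at\<close> omits its centre, so points with
        \<open>h w = h u\<close> are not covered by \<open>B(3)\<close>; for them the assumption
        \<open>c\<close> itself applies.\<close>
      using B(3) c sub that by (cases "h w = h u") auto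
  qed
qed

lemma lsc_on_continuous:
  assumes "continuous_on S h"
  shows "lsc_on S (\<lambda>u. ereal (h u))"
  unfolding lsc_on_def le_Liminf_iff
proof (intro ballI allI impI)
  fix u c assume "u \<in> S" "c < ereal (h u)"
  then show "eventually (\<lambda>w. c < ereal (h w)) (at u within S)"
    using assms by (auto simp: continuous_on_def intro: order_tendstoD(1)[OF tendsto_ereal])
qed

lemma lsc_on_add:
  assumes g: "lsc_on S g" and h: "lsc_on S h"
    and nn: "\<And>u. u \<in> S \<Longrightarrow> 0 \<le> g u" "\<And>u. u \<in> S \<Longrightarrow> 0 \<le> h u"
  shows "lsc_on S (\<lambda>u. g u + h u)"
  unfolding lsc_on_def
proof
  fix u assume u: "u \<in> S"
  have ev: "eventually (\<lambda>w. 0 \<le> g w) (at u within S)" "eventually (\<lambda>w. 0 \<le> h w) (at u within S)"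
    using nn by (auto simp: eventually_at_topological)
  show "g u + h u \<le> Liminf (at u within S) (\<lambda>u. g u + h u)"
  \<comment> \<open>At an isolated point the filter is trivial and \<open>Liminf\<close> is
    \<infinity>; the superadditivity of \<open>Liminf\<close> requires a nontrivial filter.\<close>
  proof (cases "at u within S = bot")
    case True then show ?thesis by simp
  next
    case False
    have "g u + h u \<le> Liminf (at u within S) g + Liminf (at u within S) h"
      using g h u unfolding lsc_on_def by (intro add_mono) auto
    also have "\<dots> \<le> Liminf (at u within S) (\<lambda>u. g u + h u)"
      by (rule Liminf_add_le[OF False ev])
    finally show ?thesis .
  qed
qed

text \<open>Multiplication by a positive real is an order isomorphism of the extended reals, so a
  threshold \<open>d\<close> becomes \<open>d / c\<close>.\<close>

lemma lsc_on_cmult: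
  assumes g: "lsc_on S g" and c: "0 < c"
  shows "lsc_on S (\<lambda>u. ereal c * g u)"
  unfolding lsc_on_def le_Liminf_iff
proof (intro ballI allI impI)
  fix u d assume u: "u \<in> S" and d: "d < ereal c * g u"
  have eq: "d < ereal c * w \<longleftrightarrow> d / ereal c < w" for w
    using c by (subst ereal_divide_less_iff) (auto simp: mult.commute)
  show "eventually (\<lambda>w. d < ereal c * g w) (at u within S)"
    using lsc_onD[OF g u] d unfolding eq by blast
qed

lemma lsc_on_sum:
  assumes "finite I" "\<And>i. i \<in> I \<Longrightarrow> lsc_on S (g i)"
    and "\<And>i u. i \<in> I \<Longrightarrow> u \<in> S \<Longrightarrow> 0 \<le> g i u"
  shows "lsc_on S (\<lambda>u. \<Sum>i\<in>I. g i u)"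
  using assms
proof (induction I rule: finite_induct)
  case empty
  then show ?case using lsc_on_continuous[of S "\<lambda>_. 0"] by (simp add: zero_ereal_def)
next
  case (insert i I)
  then show ?case by (auto intro!: lsc_on_add sum_nonneg)
qed

text \<open>Without a minimizer every \<open>u\<close> has a strictly better point
  \<open>h u\<close>, and the sets where \<open>g\<close> exceeds \<open>g (h u)\<close> form a
  relatively open cover. In a finite subcover the smallest value \<open>g (h u)\<close> is undercut,
  because \<open>h u\<close> itself lies in one of the covering sets.\<close>

lemma lsc_on_compact_attains_min:
  assumes S: "compact S" "S \<noteq> {}" and g: "lsc_on S g"
  obtains u where "u \<in> S" "\<And>w. w \<in> S \<Longrightarrow> g u \<le> g w"
proof (rule ccontr)
  assume "\<not> thesis"
  then have *: "\<forall>u\<in>S. \<exists>w\<in>S. g w < g u" using that by (meson not_le)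
  then obtain h where h: "\<And>u. u \<in> S \<Longrightarrow> h u \<in> S \<and> g (h u) < g u" by metis
  have "\<exists>B. open B \<and> u \<in> B \<and> (\<forall>w\<in>B \<inter> S. g (h u) < g w)" if u: "u \<in> S" for u
  proof -
    have "eventually (\<lambda>w. g (h u) < g w) (at u within S)" using lsc_onD[OF g u] h[OF u] by blast
    then obtain B where "open B" "u \<in> B" "\<forall>w\<in>B. w \<noteq> u \<longrightarrow> w \<in> S \<longrightarrow> g (h u) < g w"
      unfolding eventually_at_topological by blast
    moreover have "g (h u) < g u" using h[OF u] by blast
    ultimately have "\<forall>w\<in>B \<inter> S. g (h u) < g w" by (metis IntD1 IntD2)
    then show ?thesis using \<open>open B\<close> \<open>u \<in> B\<close> by blast
  qed
  then obtain B where B: "\<And>u. u \<in> S \<Longrightarrow> open (B u) \<and> u \<in> B u \<and> (\<forall>w\<in>B u \<inter> S. g (h u) < g w)" by metis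
  obtain C where C: "C \<subseteq> S" "finite C" "S \<subseteq> (\<Union>u\<in>C. B u)"
    using compactE_image[OF S(1), of S B] B by blast
  then have "C \<noteq> {}" using S(2) by auto
  define m where "m = Min ((\<lambda>u. g (h u)) ` C)"
  have "m \<in> (\<lambda>u. g (h u)) ` C" unfolding m_def using C \<open>C \<noteq> {}\<close> by (intro Min_in) auto
  then obtain u where u: "u \<in> C" "m = g (h u)" by auto
  then have "h u \<in> S" using h C(1) by blast
  then obtain w where w: "w \<in> C" "h u \<in> B w" using C(3) by blast
  then have "g (h w) < m" using B[of w] C(1) u(2) \<open>h u \<in> S\<close> by auto
  moreover have "m \<le> g (h w)" unfolding m_def using C w by (intro Min_le) auto
  ultimately show False by simp
qed

text \<open>Tychonoff's theorem; freezing the coordinates outside \<open>I\<close> at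
  \<open>d\<close> makes every factor of the full function space compact.\<close>

lemma compact_product_finite_support:
  fixes K :: "'i \<Rightarrow> 'a::topological_space set"
  assumes "\<And>i. i \<in> I \<Longrightarrow> compact (K i)"
  shows "compact {u. \<forall>i. u i \<in> (if i \<in> I then K i else {d})}"
proof -
  have "compactin (product_topology (\<lambda>i. euclidean) UNIV) (PiE UNIV (\<lambda>i. if i \<in> I then K i else {d}))"
    using assms by (auto simp: compactin_PiE compactin_euclidean_iff)
  then show ?thesis
    unfolding euclidean_product_topology compactin_euclidean_iff by (simp add: PiE_def Pi_def)
qed

section \<open>Subtrees\<close>

context scenario_tree
begin

text \<open>The relation points from child to parent, so the closure says that \<open>n\<close> is
  \<open>m\<close> or an ancestor of it. Intersecting with \<open>nodes\<close> removes the
  reflexive pair when \<open>n\<close> is not a node.\<close>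

definition subtree :: "'n \<Rightarrow> 'n set" where
  "subtree n = {m \<in> nodes. (m, n) \<in> {(m, n). m \<in> children n}\<^sup>*}"

lemma subtree_subset: "subtree n \<subseteq> nodes"
  by (auto simp: subtree_def)

lemma finite_subtree: "finite (subtree n)"
  using finite_subset[OF subtree_subset finite_nodes] .

lemma finite_children: "finite (children n)"
  using finite_nodes by (simp add: children_def)

lemma subtree_self: "n \<in> nodes \<Longrightarrow> n \<in> subtree n"
  by (simp add: subtree_def)

lemma subtree_par:
  assumes "j \<in> subtree n" "j \<noteq> n"
  shows "j \<noteq> root" "par j \<in> subtree n"
proof -
  have "(j, n) \<in> {(m, n). m \<in> children n}\<^sup>*" using assms by (simp add: subtree_def)
  then obtain k where "j \<in> children k" "(k, n) \<in> {(m, n). m \<in> children n}\<^sup>*"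
    using assms(2) by (auto elim: converse_rtranclE)
  then show "j \<noteq> root" "par j \<in> subtree n" by (auto simp: children_def subtree_def par_in)
qed

lemma subtree_closed:
  assumes "j \<in> nodes" "j \<noteq> root" "par j \<in> subtree n"
  shows "j \<in> subtree n"
  using assms by (auto simp: subtree_def children_def intro: converse_rtrancl_into_rtrancl)

lemma descendant_depth:
  assumes "(m, n) \<in> {(m, n). m \<in> children n}\<^sup>*"
  shows "m = n \<or> depth n < depth m"
  using assms by (induction rule: rtrancl_induct) (auto simp: depth_child)

text \<open>Parents are unique, so the ancestors of a node form a chain along which the depth
  strictly decreases, and each level is met at most once.\<close>

lemma ancestor_unique:
  assumes "(j, a) \<in> {(m, n). m \<in> children n}\<^sup>*" "(j, b) \<in> {(m, n). m \<in> children n}\<^sup>*"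
    and "depth a = depth b"
  shows "a = b"
  using assms
proof (induction rule: converse_rtrancl_induct)
  case base
  then show ?case using descendant_depth by fastforce
next
  case (step j k)
  \<comment> \<open>The node \<open>j\<close> is one level below \<open>k\<close>, which is at least
    as deep as \<open>a\<close>, so \<open>j\<close> is strictly deeper than
    \<open>b\<close>.\<close>
  have "j \<noteq> b"
    using step.hyps descendant_depth[of k a] depth_child[of j k] step.prems(2) by auto
  then obtain k' where "j \<in> children k'" "(k', b) \<in> {(m, n). m \<in> children n}\<^sup>*"
    using step.prems(1) by (auto elim: converse_rtranclE)
  moreover have "k' = k" using calculation(1) step.hyps(1) by (auto simp: children_def)
  ultimately show ?case using step.IH step.prems by blast
qed

lemma subtree_children_disjoint:
  assumes "m \<in> children n" "m' \<in> children n" "j \<in> subtree m" "j \<in> subtree m'"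
  shows "m = m'"
  using assms ancestor_unique[of j m m'] by (simp add: subtree_def depth_child)

lemma subtree_child_neq: "m \<in> children n \<Longrightarrow> j \<in> subtree m \<Longrightarrow> j \<noteq> n"
  using descendant_depth[of j m] depth_child[of m n] by (auto simp: subtree_def)

lemma subtree_unfold:
  assumes "n \<in> nodes"
  shows "subtree n = insert n (\<Union>m\<in>children n. subtree m)"
proof
  show "subtree n \<subseteq> insert n (\<Union>m\<in>children n. subtree m)"
    by (auto simp: subtree_def elim: rtranclE)
  show "insert n (\<Union>m\<in>children n. subtree m) \<subseteq> subtree n"
    using assms by (auto simp: subtree_def intro: rtrancl_into_rtrancl)
qed

lemma sum_subtree:
  fixes g :: "'n \<Rightarrow> 'b::comm_monoid_add"
  assumes "n \<in> nodes"
  shows "(\<Sum>j\<in>subtree n. g j) = g n + (\<Sum>m\<in>children n. \<Sum>j\<in>subtree m. g j)"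
proof -
  have "(\<Sum>j\<in>(\<Union>m\<in>children n. subtree m). g j) = (\<Sum>m\<in>children n. \<Sum>j\<in>subtree m. g j)"
    using subtree_children_disjoint finite_subtree finite_children by (intro sum.UNION_disjoint) blast+
  moreover have "n \<notin> (\<Union>m\<in>children n. subtree m)" using subtree_child_neq by blast
  ultimately show ?thesis
    using finite_subtree finite_children by (simp add: subtree_unfold[OF assms])
qed

text \<open>Induction from the leaves to the root; at a leaf the induction hypothesis is vacuous. It
  matches the recursion of \<open>value_fun\<close>.\<close>

lemma tree_induct [consumes 1, case_names node]:
  assumes "n \<in> nodes"
    and "\<And>n. n \<in> nodes \<Longrightarrow> (\<And>m. m \<in> children n \<Longrightarrow> P m) \<Longrightarrow> P n"
  shows "P n"
  using assms(1)
proof (induction n rule: wf_induct_rule[OF wf_children])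
  case (1 n)
  show ?case
  proof (rule assms(2)[OF 1(2)])
    fix m assume "m \<in> children n"
    then show "P m" using 1(1)[of m] by (simp add: children_def)
  qed
qed

end

section \<open>Value functions and subtree costs\<close>

context multistage_problem
begin

text \<open>The part of \<open>cost\<close> below \<open>n\<close>, with the link to the parent cut:
  \<open>n\<close> sees \<open>z\<close> even where \<open>x (par n)\<close> differs. The weights
  stay unconditional, so its infimum over feasible decisions is \<open>p n * value_fun n z\<close>
  for \<open>z\<close> in \<open>parent_set n\<close>.\<close>

definition subtree_cost :: "'n \<Rightarrow> 'x \<Rightarrow> ('n \<Rightarrow> 'x) \<Rightarrow> ('n \<Rightarrow> 'y) \<Rightarrow> ereal" where
  "subtree_cost n z x y =
     (\<Sum>j\<in>subtree n. ereal (p j) * f j (if j = n then z else x (par j)) (y j) (x j))"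

lemma subtree_cost_cong:
  assumes "\<And>j. j \<in> subtree n \<Longrightarrow> x j = x' j" "\<And>j. j \<in> subtree n \<Longrightarrow> y j = y' j"
  shows "subtree_cost n z x y = subtree_cost n z x' y'"
  unfolding subtree_cost_def using assms subtree_par(2) by (intro sum.cong) auto

lemma subtree_cost_unfold:
  assumes "n \<in> nodes"
  shows "subtree_cost n z x y =
    ereal (p n) * f n z (y n) (x n) + (\<Sum>m\<in>children n. subtree_cost m (x n) x y)"
proof -
  have "(\<Sum>j\<in>subtree m. ereal (p j) * f j (if j = n then z else x (par j)) (y j) (x j))
      = subtree_cost m (x n) x y" if m: "m \<in> children n" for m
    unfolding subtree_cost_def
  proof (rule sum.cong)
    fix j assume "j \<in> subtree m"
    then have "j \<noteq> n" using subtree_child_neq[OF m] by blast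
    moreover have "par m = n" using m by (simp add: children_def)
    ultimately show "ereal (p j) * f j (if j = n then z else x (par j)) (y j) (x j)
      = ereal (p j) * f j (if j = m then x n else x (par j)) (y j) (x j)" by simp
  qed simp
  then show ?thesis by (simp add: subtree_cost_def[of n] sum_subtree[OF assms])
qed

lemma child_in_nodes: "m \<in> children n \<Longrightarrow> m \<in> nodes"
  by (simp add: children_def)

lemma parent_set_child: "m \<in> children n \<Longrightarrow> (x, y) \<in> F n \<Longrightarrow> x \<in> parent_set m"
  by (force simp: children_def parent_set_def state_set_def)

lemma parent_state_in_parent_set:
  "feasible x y \<Longrightarrow> n \<in> nodes \<Longrightarrow> parent_state x n \<in> parent_set n"
  unfolding feasible_def parent_state_def parent_set_def state_set_def
  using par_in[of n] by (auto intro!: rev_image_eqI)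

lemma f_nonneg': "n \<in> nodes \<Longrightarrow> z \<in> parent_set n \<Longrightarrow> (x, y) \<in> F n \<Longrightarrow> 0 \<le> f n z y x"
  by (rule f_nonneg) (simp_all add: cost_domain_def)

text \<open>This excludes -\<infinity> and licenses the distributive laws of \<open>ereal\<close>
  used below.\<close>

lemma value_fun_nonneg:
  assumes "n \<in> nodes" "z \<in> parent_set n"
  shows "0 \<le> value_fun n z"
  using assms
proof (induction n arbitrary: z rule: tree_induct)
  case (node n)
  show ?case
    unfolding value_fun.simps[of n z]
  proof (rule INF_greatest, clarify)
    fix a b assume ab: "(a, b) \<in> F n"
    have "0 \<le> ereal (p m / p n) * value_fun m a" if "m \<in> children n" for m
      using node.IH[OF that parent_set_child[OF that ab]] p_pos[OF node.hyps(1)]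
        p_pos[OF child_in_nodes[OF that]] by simp
    then have "0 \<le> (\<Sum>m\<in>children n. ereal (p m / p n) * value_fun m a)" by (rule sum_nonneg)
    then show "0 \<le> f n z b a + (\<Sum>m\<in>children n. ereal (p m / p n) * value_fun m a)"
      using f_nonneg'[OF node.hyps(1) node.prems ab] by simp
  qed
qed

text \<open>Scaling the Bellman recursion by \<open>p n\<close> turns the conditional probabilities
  \<open>p m / p n\<close> into \<open>p m\<close>; nonnegativity permits distributing over the
  sum.\<close>

lemma weighted_stage_cost:
  assumes n: "n \<in> nodes" and z: "z \<in> parent_set n" and ab: "(a, b) \<in> F n"
  shows "ereal (p n) * (f n z b a + (\<Sum>m\<in>children n. ereal (p m / p n) * value_fun m a)) =
    ereal (p n) * f n z b a + (\<Sum>m\<in>children n. ereal (p m) * value_fun m a)"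
proof -
  have pn: "0 < p n" using p_pos n by blast
  have nn: "0 \<le> ereal (p m / p n) * value_fun m a" if "m \<in> children n" for m
    using value_fun_nonneg[OF child_in_nodes[OF that] parent_set_child[OF that ab]] pn
      p_pos[OF child_in_nodes[OF that]] by simp
  have "ereal (p n) * (ereal (p m / p n) * value_fun m a) = ereal (p m) * value_fun m a" for m
    using pn by (simp add: mult.assoc[symmetric])
  then have "ereal (p n) * (\<Sum>m\<in>children n. ereal (p m / p n) * value_fun m a)
      = (\<Sum>m\<in>children n. ereal (p m) * value_fun m a)"
    using nn by (simp add: sum_ereal_right_distrib)
  then show ?thesis
    using f_nonneg'[OF n z ab] sum_nonneg[of "children n", OF nn] by (simp add: ereal_right_distrib)
qed

text \<open>The decisions \<open>x\<close>, \<open>y\<close> are candidates in every minimization of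
  the recursion.\<close>

lemma value_fun_le_subtree_cost:
  assumes "n \<in> nodes" "z \<in> parent_set n" and xy: "feasible x y"
  shows "ereal (p n) * value_fun n z \<le> subtree_cost n z x y"
  using assms(1,2)
proof (induction n arbitrary: z rule: tree_induct)
  case (node n)
  have F: "(x n, y n) \<in> F n" using xy node.hyps by (simp add: feasible_def)
  have "ereal (p n) * value_fun n z \<le>
      ereal (p n) * (f n z (y n) (x n) + (\<Sum>m\<in>children n. ereal (p m / p n) * value_fun m (x n)))"
    unfolding value_fun.simps[of n z] using F p_pos[OF node.hyps(1)]
    by (intro ereal_mult_left_mono INF_lower2[of "(x n, y n)"]) auto
  also have "\<dots> = ereal (p n) * f n z (y n) (x n) + (\<Sum>m\<in>children n. ereal (p m) * value_fun m (x n))"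
    by (rule weighted_stage_cost[OF node.hyps(1) node.prems F])
  also have "\<dots> \<le> subtree_cost n z x y"
    unfolding subtree_cost_unfold[OF node.hyps(1)]
    using node.IH parent_set_child F by (intro add_left_mono sum_mono) blast
  finally show ?case .
qed

text \<open>The converse bound up to \<open>e\<close>: a near-minimizer at \<open>n\<close> is glued
  to near-optimal decisions in the disjoint subtrees of its children.\<close>

lemma value_fun_approx:
  assumes "n \<in> nodes" "z \<in> parent_set n" "0 < e"
  shows "\<exists>x y. feasible x y \<and> subtree_cost n z x y \<le> ereal (p n) * value_fun n z + ereal e"
  using assms
proof (induction n arbitrary: z e rule: tree_induct)
  case (node n)
  note n = node.hyps(1)
  have pn: "0 < p n" using p_pos n by blast
  obtain x0 y0 where feas0: "feasible x0 y0" using finite_cost by blast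
  \<comment> \<open>The budget \<open>e\<close> is split into equal shares, one for each child and
    one for \<open>n\<close> itself. The share of \<open>n\<close> appears below as
    \<open>d / p n\<close>, since its stage is scaled by \<open>p n\<close>.\<close>
  define d where "d = e / (real (card (children n)) + 1)"
  have "(real (card (children n)) + 1) * d = e"
    by (simp add: d_def add_nonneg_eq_0_iff)
  then have "d + real (card (children n)) * d = e"
    by (simp add: algebra_simps)
  moreover have "0 < d"
    using node.prems(2) by (simp add: d_def)
  ultimately have d: "0 < d" "d + real (card (children n)) * d = e" by blast+
  define G where "G = (\<lambda>(a, b). f n z b a + (\<Sum>m\<in>children n. ereal (p m / p n) * value_fun m a))"
  have V: "value_fun n z = (INF ab\<in>F n. G ab)"
    unfolding value_fun.simps[of n z] G_def by simp
  obtain a b where ab: "(a, b) \<in> F n" "G (a, b) \<le> value_fun n z + ereal (d / p n)"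
  \<comment> \<open>An infinite value is matched by any feasible pair; a finite one is strictly
    exceeded after adding a positive amount.\<close>
  proof (cases "value_fun n z = \<infinity>")
    case True
    then show thesis using that[of "x0 n" "y0 n"] feas0 n by (simp add: feasible_def)
  next
    case False
    then have "value_fun n z < value_fun n z + ereal (d / p n)"
      using value_fun_nonneg[OF n node.prems(1)] d pn by (cases "value_fun n z") auto
    then obtain ab where "ab \<in> F n" "G ab < value_fun n z + ereal (d / p n)"
      by (subst (asm) (1) V) (auto simp: INF_less_iff)
    then show thesis using that[of "fst ab" "snd ab"] by simp
  qed
  have "\<exists>x y. feasible x y \<and> subtree_cost m a x y \<le> ereal (p m) * value_fun m a + ereal d"
    if "m \<in> children n" for m
    using node.IH[OF that parent_set_child[OF that ab(1)] d(1)] .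
  then obtain X Y where XY: "\<And>m. m \<in> children n \<Longrightarrow> feasible (X m) (Y m)"
    "\<And>m. m \<in> children n \<Longrightarrow> subtree_cost m a (X m) (Y m) \<le> ereal (p m) * value_fun m a + ereal d"
    by metis
  \<comment> \<open>\<open>br j\<close> is the child of \<open>n\<close> whose subtree contains
    \<open>j\<close>, unique by disjointness. Outside the subtree of \<open>n\<close> the feasible
    point \<open>x0\<close>, \<open>y0\<close> fills in.\<close>
  define br where "br j = (SOME m. m \<in> children n \<and> j \<in> subtree m)" for j
  have br: "br j = m" if "m \<in> children n" "j \<in> subtree m" for m j
    unfolding br_def using that subtree_children_disjoint by (intro some_equality) blast+
  define below where "below = (\<Union>m\<in>children n. subtree m)"
  define x where "x j = (if j = n then a else if j \<in> below then X (br j) j else x0 j)" for j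
  define y where "y j = (if j = n then b else if j \<in> below then Y (br j) j else y0 j)" for j
  have "feasible x y"
    unfolding feasible_def
  proof
    fix j assume j: "j \<in> nodes"
    show "(x j, y j) \<in> F j"
    proof (cases "j \<noteq> n \<and> j \<in> below")
      case True
      then obtain m where "m \<in> children n" "j \<in> subtree m" by (auto simp: below_def)
      then show ?thesis using True XY(1)[of m] br j by (simp add: x_def y_def feasible_def)
    next
      case False
      then show ?thesis using ab(1) feas0 j by (auto simp: x_def y_def feasible_def)
    qed
  qed
  moreover have "subtree_cost n z x y \<le> ereal (p n) * value_fun n z + ereal e"
  proof -
    have "subtree_cost m a x y = subtree_cost m a (X m) (Y m)" if m: "m \<in> children n" for m
    proof (rule subtree_cost_cong)
      fix j assume j: "j \<in> subtree m"
      then have "j \<noteq> n" "j \<in> below" using subtree_child_neq[OF m] m by (auto simp: below_def)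
      then show "x j = X m j" "y j = Y m j" using br[OF m j] by (simp_all add: x_def y_def)
    qed
    then have "(\<Sum>m\<in>children n. subtree_cost m a x y)
        \<le> (\<Sum>m\<in>children n. ereal (p m) * value_fun m a + ereal d)"
      using XY(2) by (intro sum_mono) auto
    also have "\<dots> = (\<Sum>m\<in>children n. ereal (p m) * value_fun m a) + ereal (real (card (children n)) * d)"
      by (simp add: sum.distrib)
    finally have "subtree_cost n z x y \<le> ereal (p n) * f n z b a +
        ((\<Sum>m\<in>children n. ereal (p m) * value_fun m a) + ereal (real (card (children n)) * d))"
      unfolding subtree_cost_unfold[OF n] by (simp add: x_def y_def add_left_mono)
    also have "\<dots> = ereal (p n) * G (a, b) + ereal (real (card (children n)) * d)"
      using weighted_stage_cost[OF n node.prems(1) ab(1)] by (simp add: G_def add.assoc)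
    also have "\<dots> \<le> ereal (p n) * (value_fun n z + ereal (d / p n)) + ereal (real (card (children n)) * d)"
      using ab(2) pn by (intro add_right_mono ereal_mult_left_mono) auto
    also have "\<dots> = ereal (p n) * value_fun n z + ereal d + ereal (real (card (children n)) * d)"
      using value_fun_nonneg[OF n node.prems(1)] pn d(1) by (simp add: ereal_right_distrib)
    also have "\<dots> = ereal (p n) * value_fun n z + ereal e"
      using d(2) by (simp add: add.assoc)
    finally show ?thesis .
  qed
  ultimately show ?case by blast
qed

section \<open>Exact penalties\<close>

lemma compact_parent_set: "n \<in> nodes \<Longrightarrow> compact (parent_set n)"
  unfolding parent_set_def state_set_def
  using compact_F[OF par_in[of n]] by (auto intro!: compact_continuous_image continuous_intros)

text \<open>Exactness speaks only about minimizers of the regularized problem, so one must exist for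
  it to say anything. Existence follows from compactness and lower semicontinuity, with the
  decisions and copies of all nodes packed into one function \<open>u\<close>.\<close>

lemma reg_optimal_exists:
  assumes \<nu>: "is_norm \<nu>" and \<sigma>: "\<forall>n\<in>nodes. 0 < \<sigma> n" and \<psi>: "\<forall>n\<in>nodes. \<forall>x. \<psi> n x = \<nu> x"
  shows "\<exists>x y z. reg_optimal \<sigma> \<psi> x y z"
proof -
  define K where "K n = F n \<times> parent_set n" for n
  \<comment> \<open>Values outside \<open>nodes\<close> are fixed at 0, since feasibility leaves
    them unbounded.\<close>
  define S where "S = {u. \<forall>n. u n \<in> (if n \<in> nodes then K n else {0})}"
  define X where "X u n = fst (fst (u n))" for u :: "'n \<Rightarrow> ('x \<times> 'y) \<times> 'x" and n
  define Y where "Y u n = snd (fst (u n))" for u :: "'n \<Rightarrow> ('x \<times> 'y) \<times> 'x" and n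
  define Z where "Z u n = snd (u n)" for u :: "'n \<Rightarrow> ('x \<times> 'y) \<times> 'x" and n
  have coord: "continuous_on S (\<lambda>u. u n)" for n
    by (rule continuous_on_subset[OF continuous_on_product_coordinates subset_UNIV])
  have cont: "continuous_on S (\<lambda>u. X u n)" "continuous_on S (\<lambda>u. Y u n)" "continuous_on S (\<lambda>u. Z u n)" for n
    unfolding X_def Y_def Z_def by (rule continuous_on_fst continuous_on_snd coord)+
  have feas: "reg_feasible (X u) (Y u) (Z u)" if "u \<in> S" for u
    unfolding reg_feasible_def feasible_def
  proof (intro conjI ballI)
    fix n assume "n \<in> nodes"
    then have "u n \<in> F n \<times> parent_set n" using that by (auto simp: S_def K_def dest: spec[of _ n])
    then show "(X u n, Y u n) \<in> F n" "Z u n \<in> parent_set n" by (auto simp: X_def Y_def Z_def)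
  qed
  \<comment> \<open>The cost reads values at nodes only, parents of non-root nodes included, so
    passing to \<open>S\<close> loses no attainable cost.\<close>
  have restrict: "\<exists>u\<in>S. reg_cost \<sigma> \<psi> (X u) (Y u) (Z u) = reg_cost \<sigma> \<psi> x y z"
    if "reg_feasible x y z" for x y z
  proof
    let ?u = "\<lambda>n. if n \<in> nodes then ((x n, y n), z n) else 0"
    show "?u \<in> S" using that by (auto simp: S_def K_def reg_feasible_def feasible_def)
    show "reg_cost \<sigma> \<psi> (X ?u) (Y ?u) (Z ?u) = reg_cost \<sigma> \<psi> x y z"
      unfolding reg_cost_def by (intro sum.cong) (auto simp: X_def Y_def Z_def parent_state_def par_in)
  qed
  have "compact S"
    unfolding S_def K_def
    by (intro compact_product_finite_support compact_Times compact_F compact_parent_set)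
  moreover have "S \<noteq> {}"
  proof -
    obtain x y where "feasible x y" using finite_cost by blast
    then have "reg_feasible x y (parent_state x)"
      by (simp add: reg_feasible_def parent_state_in_parent_set)
    then show ?thesis using restrict by blast
  qed
  moreover have "lsc_on S (\<lambda>u. reg_cost \<sigma> \<psi> (X u) (Y u) (Z u))"
    unfolding reg_cost_def
  proof (rule lsc_on_sum[OF finite_nodes])
    fix n assume n: "n \<in> nodes"
    have dom: "(\<lambda>u. (Z u n, Y u n, X u n)) ` S \<subseteq> cost_domain n"
      using feas n by (auto simp: reg_feasible_def feasible_def cost_domain_def)
    have f0: "0 \<le> f n (Z u n) (Y u n) (X u n)" if "u \<in> S" for u
      using dom that by (intro f_nonneg[OF n]) auto
    have pen0: "0 \<le> \<sigma> n * \<psi> n v" for v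
      using \<sigma> \<psi> n is_norm_nonneg[OF \<nu>] by (simp add: less_imp_le)
    have "lsc_on S (\<lambda>u. f n (Z u n) (Y u n) (X u n))"
      using lsc_on_compose[OF f_lsc[OF n] _ dom] by (simp add: continuous_intros cont)
    moreover have "continuous_on S (\<lambda>u. \<sigma> n * \<psi> n (parent_state (X u) n - Z u n))"
    proof -
      have "continuous_on S (\<lambda>u. parent_state (X u) n - Z u n)"
        by (cases "n = root") (auto simp: parent_state_def intro!: continuous_intros cont)
      then have "continuous_on S (\<lambda>u. \<nu> (parent_state (X u) n - Z u n))"
        by (intro continuous_on_compose2[OF is_norm_continuous[OF \<nu>]]) auto
      then show ?thesis using \<psi> n by (simp add: continuous_intros)
    qed
    ultimately show "lsc_on S (\<lambda>u. ereal (p n) * (f n (Z u n) (Y u n) (X u n)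
        + ereal (\<sigma> n * \<psi> n (parent_state (X u) n - Z u n))))"
      using f0 pen0 p_pos[OF n] by (intro lsc_on_cmult lsc_on_add lsc_on_continuous) auto
    show "0 \<le> ereal (p n) * (f n (Z u n) (Y u n) (X u n)
        + ereal (\<sigma> n * \<psi> n (parent_state (X u) n - Z u n)))" if "u \<in> S" for u
      using f0[OF that] pen0 p_pos[OF n] by (intro ereal_0_le_mult add_nonneg_nonneg) auto
  qed
  ultimately obtain u where u: "u \<in> S"
    "\<And>w. w \<in> S \<Longrightarrow> reg_cost \<sigma> \<psi> (X u) (Y u) (Z u) \<le> reg_cost \<sigma> \<psi> (X w) (Y w) (Z w)"
    using lsc_on_compact_attains_min[of S "\<lambda>u. reg_cost \<sigma> \<psi> (X u) (Y u) (Z u)"] by blast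
  have "reg_optimal \<sigma> \<psi> (X u) (Y u) (Z u)"
    unfolding reg_optimal_def using feas[OF u(1)] restrict u(2) by metis
  then show ?thesis by blast
qed

text \<open>At a regularized minimizer the copies equal the parent states, the penalties vanish, and
  its regularized cost is the original cost of a feasible point.\<close>

lemma optimal_le_reg_cost:
  assumes \<nu>: "is_norm \<nu>" and \<sigma>: "\<forall>n\<in>nodes. 0 < \<sigma> n" and \<psi>: "\<forall>n\<in>nodes. \<forall>x. \<psi> n x = \<nu> x"
    and exact: "exact_regularization \<sigma> \<psi>" and opt: "optimal xb yb" and feas: "reg_feasible x y z"
  shows "cost xb yb \<le> reg_cost \<sigma> \<psi> x y z"
proof -
  obtain x' y' z' where reg: "reg_optimal \<sigma> \<psi> x' y' z'"
    using reg_optimal_exists[OF \<nu> \<sigma> \<psi>] by blast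
  then have z': "\<forall>n\<in>nodes. z' n = parent_state x' n"
    using exact by (simp add: exact_regularization_def)
  have \<nu>0: "\<nu> 0 = 0" using \<nu> by (simp add: is_norm_def)
  have "cost xb yb \<le> cost x' y'"
    using opt reg by (simp add: optimal_def reg_optimal_def reg_feasible_def)
  also have "\<dots> = reg_cost \<sigma> \<psi> x' y' z'"
    unfolding cost_def reg_cost_def using z' \<psi>
    by (intro sum.cong) (auto simp: \<nu>0 zero_ereal_def[symmetric])
  also have "\<dots> \<le> reg_cost \<sigma> \<psi> x y z"
    using reg feas by (simp add: reg_optimal_def)
  finally show ?thesis .
qed

section \<open>Splicing decisions into the subtree of a node\<close>

lemma subtree_cost_nonneg:
  assumes "n \<in> nodes" "z \<in> parent_set n" "feasible x y"
  shows "0 \<le> subtree_cost n z x y"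
  using value_fun_le_subtree_cost[OF assms] value_fun_nonneg[OF assms(1,2)] p_pos[OF assms(1)]
  by (meson ereal_0_le_mult ereal_less_eq(5) less_imp_le order_trans)

lemma cost_split_subtree:
  assumes "n \<in> nodes - {root}"
  shows "cost x y = subtree_cost n (x (par n)) x y +
    (\<Sum>j\<in>nodes - subtree n. ereal (p j) * f j (parent_state x j) (y j) (x j))"
proof -
  have "(\<Sum>j\<in>subtree n. ereal (p j) * f j (parent_state x j) (y j) (x j)) = subtree_cost n (x (par n)) x y"
    unfolding subtree_cost_def using assms subtree_par(1)
    by (intro sum.cong) (auto simp: parent_state_def)
  then show ?thesis
    unfolding cost_def using sum.subset_diff[OF subtree_subset finite_nodes, of _ n]
    by (metis add.commute)
qed

lemma par_notin_subtree:
  assumes "n \<in> nodes - {root}"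
  shows "par n \<notin> subtree n"
proof
  assume "par n \<in> subtree n"
  moreover have "n \<in> children (par n)" using assms by (simp add: children_def)
  ultimately show False using subtree_child_neq[of n "par n" "par n"] by blast
qed

text \<open>Replacing the optimal decisions below \<open>n\<close> by others that start from a copy \<open>z\<close> of the
  parent state gives a point of the regularized problem whose only penalty is paid at \<open>n\<close>.\<close>

lemma subtree_cost_exact_penalty:
  assumes \<nu>: "is_norm \<nu>" and \<sigma>: "\<forall>n\<in>nodes. 0 < \<sigma> n" and \<psi>: "\<forall>n\<in>nodes. \<forall>x. \<psi> n x = \<nu> x"
    and exact: "exact_regularization \<sigma> \<psi>" and opt: "optimal xb yb"
    and n: "n \<in> nodes - {root}" and z: "z \<in> parent_set n" and xy: "feasible x y"
  shows "subtree_cost n (xb (par n)) xb yb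
    \<le> subtree_cost n z x y + ereal (p n * \<sigma> n * \<nu> (xb (par n) - z))"
proof -
  define x' where "x' j = (if j \<in> subtree n then x j else xb j)" for j
  define y' where "y' j = (if j \<in> subtree n then y j else yb j)" for j
  \<comment> \<open>Every copy except the one at \<open>n\<close> equals the spliced parent state,
    so only \<open>n\<close> pays a penalty.\<close>
  define z' where "z' j = (if j = n then z else parent_state x' j)" for j
  define R where "R = (\<Sum>j\<in>nodes - subtree n. ereal (p j) * f j (parent_state xb j) (yb j) (xb j))"
  let ?c = "p n * \<sigma> n * \<nu> (xb (par n) - z)"
  have feasb: "feasible xb yb" using opt by (simp add: optimal_def)
  have feas': "feasible x' y'" using xy feasb by (simp add: feasible_def x'_def y'_def)
  then have reg: "reg_feasible x' y' z'"
    using z parent_state_in_parent_set by (simp add: reg_feasible_def z'_def)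
  have pen: "ereal (p j) * (f j (z' j) (y' j) (x' j) + ereal (\<sigma> j * \<psi> j (parent_state x' j - z' j)))
      = ereal (p j) * f j (z' j) (y' j) (x' j) + ereal (if j = n then ?c else 0)" if j: "j \<in> nodes" for j
  proof -
    have "0 \<le> f j (z' j) (y' j) (x' j)"
      using reg j by (intro f_nonneg') (auto simp: reg_feasible_def feasible_def)
    moreover have "0 \<le> \<sigma> j * \<psi> j (parent_state x' j - z' j)"
      using j \<sigma> \<psi> is_norm_nonneg[OF \<nu>] by (simp add: less_imp_le)
    \<comment> \<open>As \<open>par n\<close> lies outside the subtree, its state in the splice is
      still \<open>xb (par n)\<close>.\<close>
    moreover have "p j * (\<sigma> j * \<psi> j (parent_state x' j - z' j)) = (if j = n then ?c else 0)"
      using n j \<psi> \<nu> par_notin_subtree[OF n]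
      by (auto simp: z'_def parent_state_def x'_def is_norm_def)
    ultimately show ?thesis by (simp add: ereal_right_distrib)
  qed
  have "(\<Sum>j\<in>subtree n. ereal (p j) * f j (z' j) (y' j) (x' j)) = subtree_cost n z x y"
    unfolding subtree_cost_def
    by (intro sum.cong) (auto simp: z'_def x'_def y'_def parent_state_def subtree_par)
  moreover have "(\<Sum>j\<in>nodes - subtree n. ereal (p j) * f j (z' j) (y' j) (x' j)) = R"
    unfolding R_def
  proof (rule sum.cong)
    fix j assume j: "j \<in> nodes - subtree n"
    then have "j \<noteq> n" using subtree_self by blast
    \<comment> \<open>A node outside the subtree has its parent outside too, so its incoming state
      is unchanged.\<close>
    moreover have "parent_state x' j = parent_state xb j"
      using j subtree_closed[of j n] by (auto simp: parent_state_def x'_def)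
    ultimately show "ereal (p j) * f j (z' j) (y' j) (x' j)
        = ereal (p j) * f j (parent_state xb j) (yb j) (xb j)"
      using j by (simp add: z'_def x'_def y'_def)
  qed simp
  ultimately have "(\<Sum>j\<in>nodes. ereal (p j) * f j (z' j) (y' j) (x' j)) = R + subtree_cost n z x y"
    using sum.subset_diff[OF subtree_subset finite_nodes,
        of "\<lambda>j. ereal (p j) * f j (z' j) (y' j) (x' j)" n] by simp
  then have "reg_cost \<sigma> \<psi> x' y' z' = R + subtree_cost n z x y + ereal ?c"
    unfolding reg_cost_def using n finite_nodes by (simp add: pen sum.distrib cong: sum.cong)
  moreover have "cost xb yb = R + subtree_cost n (xb (par n)) xb yb"
    using cost_split_subtree[OF n] by (simp add: R_def add.commute)
  ultimately have le: "R + subtree_cost n (xb (par n)) xb yb \<le> R + (subtree_cost n z x y + ereal ?c)"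
    using optimal_le_reg_cost[OF \<nu> \<sigma> \<psi> exact opt reg] by (simp add: add.assoc)
  \<comment> \<open>Finiteness of the optimal cost makes \<open>R\<close> finite, so that it can be
    cancelled in \<open>ereal\<close>.\<close>
  have "R + subtree_cost n (xb (par n)) xb yb < \<infinity>"
    using opt finite_cost \<open>cost xb yb = _\<close> by (metis optimal_def order_le_less_trans)
  moreover have "0 \<le> R"
    unfolding R_def using feasb p_pos parent_state_in_parent_set
    by (intro sum_nonneg ereal_0_le_mult f_nonneg') (auto simp: feasible_def less_imp_le)
  ultimately have "R \<noteq> \<infinity>" "R \<noteq> - \<infinity>" by auto
  then show ?thesis using le by (simp add: ereal_add_le_add_iff)
qed

section \<open>Convexity of subtree costs\<close>

text \<open>Each summand is a jointly convex cost evaluated at a linear function of the parent copy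
  and all decisions. \<open>comb\<close> and \<open>comby\<close> are the same combination on the
  state and the internal space.\<close>

lemma subtree_cost_convex:
  assumes cvx: convex_problem and n: "n \<in> nodes"
    and z: "z \<in> parent_set n" and xy: "feasible x y"
    and z': "z' \<in> parent_set n" and xy': "feasible x' y'"
    and t: "t \<in> {0..1}"
  defines "comb \<equiv> \<lambda>a b. (1 - t) *\<^sub>R a + t *\<^sub>R b"
    and "comby \<equiv> \<lambda>a b. (1 - t) *\<^sub>R a + t *\<^sub>R b"
  shows "comb z z' \<in> parent_set n"
    and "feasible (\<lambda>j. comb (x j) (x' j)) (\<lambda>j. comby (y j) (y' j))"
    and "subtree_cost n (comb z z') (\<lambda>j. comb (x j) (x' j)) (\<lambda>j. comby (y j) (y' j))
      \<le> ereal (1 - t) * subtree_cost n z x y + ereal t * subtree_cost n z' x' y'"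
proof -
  define w where "w j = (if j = n then z else x (par j))" for j
  define w' where "w' j = (if j = n then z' else x' (par j))" for j
  have dom: "(w j, y j, x j) \<in> cost_domain j" "(w' j, y' j, x' j) \<in> cost_domain j"
    if "j \<in> subtree n" for j
  proof -
    have "j \<in> nodes" using that subtree_subset by blast
    moreover have "j \<noteq> n \<Longrightarrow> x (par j) \<in> parent_set j \<and> x' (par j) \<in> parent_set j"
      using parent_state_in_parent_set[OF xy \<open>j \<in> nodes\<close>] parent_state_in_parent_set[OF xy' \<open>j \<in> nodes\<close>]
        subtree_par(1)[OF that] by (simp add: parent_state_def)
    ultimately show "(w j, y j, x j) \<in> cost_domain j" "(w' j, y' j, x' j) \<in> cost_domain j"
      using z z' xy xy' by (auto simp: cost_domain_def w_def w'_def feasible_def)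
  qed
  \<comment> \<open>Convexity of \<open>parent_set n\<close> is read off by projecting the convex
    domain of the cost at \<open>n\<close>.\<close>
  have "convex (cost_domain n)" using cvx n by (simp add: convex_problem_def ereal_convex_on_def)
  then have "(1 - t) *\<^sub>R (w n, y n, x n) + t *\<^sub>R (w' n, y' n, x' n) \<in> cost_domain n"
    using dom[OF subtree_self[OF n]] t by (intro convexD) auto
  then show "comb z z' \<in> parent_set n" by (simp add: cost_domain_def w_def w'_def comb_def)
  show "feasible (\<lambda>j. comb (x j) (x' j)) (\<lambda>j. comby (y j) (y' j))"
    unfolding feasible_def
  proof
    fix j assume j: "j \<in> nodes"
    have "(1 - t) *\<^sub>R (x j, y j) + t *\<^sub>R (x' j, y' j) \<in> F j"
      using cvx xy xy' t j by (intro convexD) (auto simp: convex_problem_def feasible_def)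
    then show "(comb (x j) (x' j), comby (y j) (y' j)) \<in> F j" by (simp add: comb_def comby_def)
  qed
  let ?g = "\<lambda>j. ereal (p j) * f j (w j) (y j) (x j)"
  let ?g' = "\<lambda>j. ereal (p j) * f j (w' j) (y' j) (x' j)"
  have nn: "0 \<le> f j (w j) (y j) (x j)" "0 \<le> f j (w' j) (y' j) (x' j)" if "j \<in> subtree n" for j
    using dom[OF that] f_nonneg subtree_subset that by blast+
  have pp: "0 < p j" if "j \<in> subtree n" for j using p_pos subtree_subset that by blast
  have summand: "ereal (p j) * f j (comb (w j) (w' j)) (comby (y j) (y' j)) (comb (x j) (x' j))
      \<le> ereal (1 - t) * ?g j + ereal t * ?g' j" if j: "j \<in> subtree n" for j
  proof -
    have "j \<in> nodes" using j subtree_subset by blast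
    then have "ereal_convex_on (cost_domain j) (\<lambda>(z, y, x). f j z y x)"
      using cvx by (simp add: convex_problem_def)
    then have "f j (comb (w j) (w' j)) (comby (y j) (y' j)) (comb (x j) (x' j))
        \<le> ereal (1 - t) * f j (w j) (y j) (x j) + ereal t * f j (w' j) (y' j) (x' j)"
      unfolding ereal_convex_on_def comb_def comby_def using dom[OF j] t by fastforce
    then have "ereal (p j) * f j (comb (w j) (w' j)) (comby (y j) (y' j)) (comb (x j) (x' j))
        \<le> ereal (p j) * (ereal (1 - t) * f j (w j) (y j) (x j) + ereal t * f j (w' j) (y' j) (x' j))"
      using pp[OF j] by (intro ereal_mult_left_mono) auto
    also have "\<dots> = ereal (1 - t) * ?g j + ereal t * ?g' j"
      using nn[OF j] t by (simp add: ereal_right_distrib mult.left_commute)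
    finally show ?thesis .
  qed
  have "subtree_cost n (comb z z') (\<lambda>j. comb (x j) (x' j)) (\<lambda>j. comby (y j) (y' j))
      = (\<Sum>j\<in>subtree n. ereal (p j) * f j (comb (w j) (w' j)) (comby (y j) (y' j)) (comb (x j) (x' j)))"
    unfolding subtree_cost_def by (intro sum.cong) (auto simp: w_def w'_def)
  also have "\<dots> \<le> (\<Sum>j\<in>subtree n. ereal (1 - t) * ?g j + ereal t * ?g' j)"
    by (intro sum_mono summand)
  also have "\<dots> = ereal (1 - t) * (\<Sum>j\<in>subtree n. ?g j) + ereal t * (\<Sum>j\<in>subtree n. ?g' j)"
    using nn pp by (simp add: sum.distrib sum_ereal_right_distrib less_imp_le)
  also have "\<dots> = ereal (1 - t) * subtree_cost n z x y + ereal t * subtree_cost n z' x' y'"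
    by (simp add: subtree_cost_def w_def w'_def)
  finally show "subtree_cost n (comb z z') (\<lambda>j. comb (x j) (x' j)) (\<lambda>j. comby (y j) (y' j))
      \<le> ereal (1 - t) * subtree_cost n z x y + ereal t * subtree_cost n z' x' y'" .
qed

text \<open>The decisions are quantified away, so this is a projection of the epigraph of a jointly
  convex function. It stands in for the epigraph of the scaled value function without appealing to
  attained minima.\<close>

lemma convex_subtree_epigraph:
  assumes convex_problem "n \<in> nodes"
  shows "convex {(z, s). z \<in> parent_set n \<and> (\<exists>x y. feasible x y \<and> subtree_cost n z x y \<le> ereal s)}"
    (is "convex ?E")
  unfolding convex_alt
proof (intro ballI allI impI)
  fix a b and t :: real
  assume ab: "a \<in> ?E" "b \<in> ?E" and t: "0 \<le> t \<and> t \<le> 1"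
  obtain z s where a: "a = (z, s)" by (cases a)
  obtain z' s' where b: "b = (z', s')" by (cases b)
  obtain x y where xy: "z \<in> parent_set n" "feasible x y" "subtree_cost n z x y \<le> ereal s"
    using ab(1) a by blast
  obtain x' y' where xy': "z' \<in> parent_set n" "feasible x' y'" "subtree_cost n z' x' y' \<le> ereal s'"
    using ab(2) b by blast
  note c = subtree_cost_convex[OF assms xy(1,2) xy'(1,2), of t]
  have "ereal (1 - t) * subtree_cost n z x y + ereal t * subtree_cost n z' x' y'
      \<le> ereal (1 - t) * ereal s + ereal t * ereal s'"
    using xy(3) xy'(3) t by (intro add_mono ereal_mult_left_mono) auto
  then show "(1 - t) *\<^sub>R a + t *\<^sub>R b \<in> ?E"
    using c t order_trans[OF c(3)] by (auto simp: a b)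
qed

section \<open>Subgradients and the closed duality gap\<close>

text \<open>Separation takes place at the scale of \<open>subtree_cost\<close>, where the penalty
  constant is \<open>p n * \<sigma> n\<close>; dividing by \<open>p n\<close> leaves a slope of dual
  norm at most \<open>\<sigma> n\<close>.\<close>

lemma value_fun_subgradient:
  assumes \<nu>: "is_norm \<nu>" and \<sigma>: "\<forall>n\<in>nodes. 0 < \<sigma> n" and \<psi>: "\<forall>n\<in>nodes. \<forall>x. \<psi> n x = \<nu> x"
    and exact: "exact_regularization \<sigma> \<psi>" and cvx: convex_problem and opt: "optimal xb yb"
    and n: "n \<in> nodes - {root}"
  obtains l r where "dual_norm \<nu> l \<le> \<sigma> n" "value_fun n (xb (par n)) = ereal r"
    "\<And>z. z \<in> parent_set n \<Longrightarrow> ereal (r + inner l (z - xb (par n))) \<le> value_fun n z"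
proof -
  let ?xp = "xb (par n)"
  define E where
    "E = {(z, s). z \<in> parent_set n \<and> (\<exists>x y. feasible x y \<and> subtree_cost n z x y \<le> ereal s)}"
  have n': "n \<in> nodes" and pn: "0 < p n" and sn: "0 < \<sigma> n" using n p_pos \<sigma> by auto
  have feasb: "feasible xb yb" using opt by (simp add: optimal_def)
  have xp: "?xp \<in> parent_set n"
    using parent_state_in_parent_set[OF feasb n'] n by (simp add: parent_state_def)
  obtain q where q: "subtree_cost n ?xp xb yb = ereal q"
  proof -
    have "cost xb yb < \<infinity>" using opt finite_cost by (metis optimal_def order_le_less_trans)
    then have "subtree_cost n ?xp xb yb \<noteq> \<infinity>" unfolding cost_split_subtree[OF n] by auto
    then show thesis using that subtree_cost_nonneg[OF n' xp feasb]
      by (cases "subtree_cost n ?xp xb yb") auto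
  qed
  have "convex E" unfolding E_def by (rule convex_subtree_epigraph[OF cvx n'])
  moreover have "(?xp, q) \<in> E" using xp feasb q by (auto simp: E_def intro!: exI[of _ xb] exI[of _ yb])
  moreover have "q \<le> s + (p n * \<sigma> n) * \<nu> (?xp - z)" if zs: "(z, s) \<in> E" for z s
  proof -
    obtain x y where xy: "z \<in> parent_set n" "feasible x y" "subtree_cost n z x y \<le> ereal s"
      using zs by (auto simp: E_def)
    have "ereal q \<le> subtree_cost n z x y + ereal (p n * \<sigma> n * \<nu> (?xp - z))"
      using subtree_cost_exact_penalty[OF \<nu> \<sigma> \<psi> exact opt n xy(1,2)] q by simp
    also have "\<dots> \<le> ereal s + ereal (p n * \<sigma> n * \<nu> (?xp - z))"
      using xy(3) by (rule add_right_mono)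
    finally show ?thesis by simp
  qed
  ultimately obtain \<mu> where \<mu>: "\<And>z. inner \<mu> z \<le> (p n * \<sigma> n) * \<nu> z"
    "\<And>z s. (z, s) \<in> E \<Longrightarrow> q + inner \<mu> (z - ?xp) \<le> s"
    using affine_minorant_of_penalty[of E \<nu> "p n * \<sigma> n" ?xp q] \<nu> pn sn by auto
  \<comment> \<open>Near-optimal decisions put \<open>(z, r + e)\<close> into \<open>E\<close>, with
    \<open>r\<close> the scaled value; then \<open>e\<close> tends to 0.\<close>
  have lower: "ereal (q + inner \<mu> (z - ?xp)) \<le> ereal (p n) * value_fun n z" if z: "z \<in> parent_set n" for z
  proof (rule ereal_le_epsilon2)
    fix e :: real assume "0 < e"
    then obtain x y where xy: "feasible x y"
      "subtree_cost n z x y \<le> ereal (p n) * value_fun n z + ereal e"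
      using value_fun_approx[OF n' z] by blast
    show "ereal (q + inner \<mu> (z - ?xp)) \<le> ereal (p n) * value_fun n z + ereal e"
    proof (cases "ereal (p n) * value_fun n z")
      case (real r)
      then have "(z, r + e) \<in> E" using xy z by (auto simp: E_def)
      then show ?thesis using \<mu>(2) real by fastforce
    next
      case MInf
      then show ?thesis using value_fun_nonneg[OF n' z] pn by (cases "value_fun n z") auto
    next
      case PInf
      then show ?thesis by (simp only: plus_ereal.simps ereal_less_eq)
    qed
  qed
  define l where "l = (1 / p n) *\<^sub>R \<mu>"
  have scaled: "ereal (q / p n + inner l (z - ?xp)) \<le> value_fun n z" if z: "z \<in> parent_set n" for z
  proof (cases "value_fun n z")
    case (real r)
    then show ?thesis using lower[OF z] pn by (simp add: l_def field_simps)
  qed (use value_fun_nonneg[OF n' z] in auto)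
  show thesis
  proof
    show "dual_norm \<nu> l \<le> \<sigma> n"
    proof (rule dual_norm_le[OF \<nu>])
      show "inner l z \<le> \<sigma> n * \<nu> z" for z using \<mu>(1)[of z] pn by (simp add: l_def field_simps)
    qed (use sn in simp)
    \<comment> \<open>The optimal decisions bound the value at \<open>xb (par n)\<close> from above
      by \<open>q / p n\<close>; the affine minorant at that point gives the reverse bound.\<close>
    have "ereal (p n) * value_fun n ?xp \<le> ereal q"
      using value_fun_le_subtree_cost[OF n' xp feasb] q by simp
    then have "value_fun n ?xp \<le> ereal (q / p n)"
      using pn by (cases "value_fun n ?xp") (auto simp: field_simps)
    then show "value_fun n ?xp = ereal (q / p n)" using scaled[OF xp] by simp
  qed (rule scaled)
qed

text \<open>Testing the inner minimum at \<open>z = xb (par n)\<close> annihilates both multiplier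
  terms and gives weak duality. Conversely, the subgradient paired with \<open>\<rho> = 0\<close> is
  an admissible multiplier, and its inequality says that the inner minimum is at least the value at
  \<open>xb (par n)\<close>.\<close>

lemma dual_value_exact:
  assumes \<nu>: "is_norm \<nu>" and \<sigma>: "\<forall>n\<in>nodes. 0 < \<sigma> n" and \<psi>: "\<forall>n\<in>nodes. \<forall>x. \<psi> n x = \<nu> x"
    and exact: "exact_regularization \<sigma> \<psi>" and cvx: convex_problem and opt: "optimal xb yb"
    and n: "n \<in> nodes - {root}" and b: "\<sigma> n \<le> bl" "0 \<le> br"
  shows "dual_value \<psi> (multiplier_set \<nu> bl br) n (xb (par n)) = value_fun n (xb (par n))"
proof (rule antisym)
  let ?xp = "xb (par n)"
  have \<psi>0: "\<psi> n (?xp - ?xp) = 0" using \<psi> n \<nu> by (simp add: is_norm_def)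
  have xp: "?xp \<in> parent_set n"
    using parent_state_in_parent_set[of xb yb n] opt n by (simp add: optimal_def parent_state_def)
  show "dual_value \<psi> (multiplier_set \<nu> bl br) n ?xp \<le> value_fun n ?xp"
    unfolding dual_value_def dual_fun_def
    by (rule SUP_least, clarify, rule INF_lower2[OF xp]) (use \<psi>0 in \<open>simp add: zero_ereal_def[symmetric]\<close>)
  obtain l r where l: "dual_norm \<nu> l \<le> \<sigma> n" "value_fun n ?xp = ereal r"
    "\<And>z. z \<in> parent_set n \<Longrightarrow> ereal (r + inner l (z - ?xp)) \<le> value_fun n z"
    using value_fun_subgradient[OF \<nu> \<sigma> \<psi> exact cvx opt n] by blast
  have "(l, 0) \<in> multiplier_set \<nu> bl br" using l(1) b by (simp add: multiplier_set_def)
  moreover have "value_fun n ?xp \<le> dual_fun \<psi> n ?xp (l, 0)"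
    unfolding dual_fun_def prod.case
  proof (rule INF_greatest)
    fix z assume "z \<in> parent_set n"
    then show "value_fun n ?xp \<le> value_fun n z + ereal (inner l (?xp - z)) + ereal (0 * \<psi> n (?xp - z))"
      using l(2) l(3)[of z] by (cases "value_fun n z") (auto simp: inner_diff_right)
  qed
  ultimately show "value_fun n ?xp \<le> dual_value \<psi> (multiplier_set \<nu> bl br) n ?xp"
    unfolding dual_value_def by (rule SUP_upper2)
qed

end

theorem proposition4:
  fixes nodes :: "'n set" and root :: 'n and par :: "'n \<Rightarrow> 'n" and p :: "'n \<Rightarrow> real"
    and F :: "'n \<Rightarrow> ('x::euclidean_space \<times> 'y::euclidean_space) set"
    and f :: "'n \<Rightarrow> 'x \<Rightarrow> 'y \<Rightarrow> 'x \<Rightarrow> ereal"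
    and \<nu> :: "'x \<Rightarrow> real" and \<psi> :: "'n \<Rightarrow> 'x \<Rightarrow> real" and \<sigma> :: "'n \<Rightarrow> real"
    and bl br :: "'n \<Rightarrow> real"
    and xb :: "'n \<Rightarrow> 'x" and yb :: "'n \<Rightarrow> 'y"
    and lam :: "'n \<Rightarrow> 'x" and rho :: "'n \<Rightarrow> real" and v :: "'n \<Rightarrow> ereal"
  assumes "multistage_problem nodes root par p F f"
    and "is_norm \<nu>"
    and "\<forall>n\<in>nodes. 0 < \<sigma> n"
    and "\<forall>n\<in>nodes. \<forall>x. \<psi> n x = \<nu> x"
    and "multistage_base.exact_regularization nodes root par p F f \<sigma> \<psi>"
    and "multistage_problem.convex_problem nodes root par F f"
    and "multistage_base.optimal nodes root par p F f xb yb"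
    and "\<forall>n\<in>nodes - {root}. \<sigma> n \<le> bl n \<and> br n = 0"
    and "\<forall>n\<in>nodes - {root}.
           v n = multistage_base.dual_value nodes root par p F f \<psi>
                   (multiplier_set \<nu> (bl n) (br n)) n (xb (par n))"
    and "\<forall>n\<in>nodes - {root}.
           multistage_base.dual_optimal nodes root par p F f \<psi>
             (multiplier_set \<nu> (bl n) (br n)) n (xb (par n)) (lam n, rho n)"
  shows "\<forall>n\<in>nodes - {root}.
           multistage_base.value_fun nodes root par p F f n (xb (par n)) =
           conjugacy_cut (\<psi> n) (xb (par n)) (v n) (lam n) (rho n) (xb (par n))"
proof
  interpret multistage_problem nodes root par p F f by (rule assms(1))
  fix n assume n: "n \<in> nodes - {root}"
  have "v n = value_fun n (xb (par n))"
    using dual_value_exact[OF assms(2-7) n, of "bl n" "br n"] assms(8,9) n by simp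
  \<comment> \<open>At its own base point the linear and the penalty term of the cut vanish, leaving
    \<open>v n\<close>.\<close>
  moreover have "\<psi> n 0 = 0" using assms(2,4) n by (simp add: is_norm_def)
  ultimately show "value_fun n (xb (par n)) =
      conjugacy_cut (\<psi> n) (xb (par n)) (v n) (lam n) (rho n) (xb (par n))"
    by (simp add: conjugacy_cut_def zero_ereal_def[symmetric])
qed

end
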